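(* Let $S$ be a compact semitopological semigroup. The following are equivalent: (1) $S$ is algebraically a group (i.e. $S$, as a set with its product, is a group); (2) $(C(S),\Delta)$ has the weak cancellation laws.
   Context: A compact semitopological semigroup is a (nonempty) compact Hausdorff space $S$ with an associative product such that for each $s\in S$ the maps $t\mapsto ts$ and $t\mapsto st$ are continuous. $C(S)^{**}$ is the bidual of $C(S)$, identified with its universal enveloping von Neumann algebra; $\overline{\otimes}$ is the von Neumann algebraic tensor product. For $f\in C(S)$, the bounded separately continuous function $\Delta(f)(s,t):=f(st)$ on $S\times S$ is viewed as an element of $C(S)^{**}\overline{\otimes}C(S)^{**}$; this makes $\Delta:C(S)\to C(S)^{**}\overline{\otimes}C(S)^{**}$ a unital $*$-homomorphism. For $\mu\in C(S)^*$ with normal extension $\widetilde{\mu}$ to $C(S)^{**}$, the slices $(\widetilde{\mu}\otimes\mathrm{id})(\Delta(f))$ and $(\mathrm{id}\otimes\widetilde{\mu})(\Delta(f))$ belong to $C(S)$; concretely, identifying $\mu$ with a regular Borel measure, they are the functions $t\mapsto\int_S f(st)\,d\mu(s)$ and $s\mapsto\int_S f(st)\,d\mu(t)$ respectively. Write $f\star\mu:=(\widetilde{\mu}\otimes\mathrm{id})(\Delta(f))$ and $\mu\star f:=(\mathrm{id}\otimes\widetilde{\mu})(\Delta(f))$, and for $g\in C(S)$ let $\mu g\in C(S)^*$ be $x\mapsto\mu(gx)$. $(C(S),\Delta)$ has the weak cancellation laws if for every state $\omega$ on $C(S)$ both linear spans $\mathrm{Lin}\{f\star(\omega g): f,g\in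 C(S)\}$ and $\mathrm{Lin}\{(\omega g)\star f: f,g\in C(S)\}$ are norm dense in $C(S)$. *)

theory Defs
  imports "HOL-Analysis.Analysis"
begin

locale compact_semitopological_semigroup = semigroup m
  for m :: "'a::t2_space \<Rightarrow> 'a \<Rightarrow> 'a" (infixl \<open>\<cdot>\<close> 70) +
  assumes compact_UNIV: "compact (UNIV :: 'a set)"
    and continuous_right_translation: "continuous_on UNIV (\<lambda>t. t \<cdot> s)"
    and continuous_left_translation: "continuous_on UNIV (\<lambda>t. s \<cdot> t)"

text \<open>
  For compact \<open>S\<close> every continuous function is bounded, so the Banach space \<open>C(S)\<close> is the
  type of bounded continuous functions \<open>S \<Rightarrow>\<^sub>C complex\<close> with its supremum norm.  The library
  provides it only as a real normed space; the pointwise product and the complex scalar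
  multiplication (product with a constant function) are added here.
\<close>

instantiation bcontfun :: (topological_space, real_normed_algebra) real_normed_algebra
begin

definition times_bcontfun :: "('a \<Rightarrow>\<^sub>C 'b) \<Rightarrow> ('a \<Rightarrow>\<^sub>C 'b) \<Rightarrow> 'a \<Rightarrow>\<^sub>C 'b"
  where "times_bcontfun f g = Bcontfun (\<lambda>x. apply_bcontfun f x * apply_bcontfun g x)"

lemma apply_times_bcontfun [simp]:
  "apply_bcontfun (f * g) x = apply_bcontfun f x * apply_bcontfun g x" for f g :: "'a \<Rightarrow>\<^sub>C 'b"
proof -
  have "norm (apply_bcontfun f x * apply_bcontfun g x) \<le> norm f * norm g" for x
    by (rule order_trans[OF norm_mult_ineq]) (intro mult_mono norm_bounded; simp)
  then have "(\<lambda>x. apply_bcontfun f x * apply_bcontfun g x) \<in> bcontfun"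
    by (intro bcontfun_normI[where b = "norm f * norm g"] continuous_intros) auto
  then show ?thesis
    by (simp add: times_bcontfun_def Bcontfun_inverse)
qed

instance
proof
  fix a b c :: "'a \<Rightarrow>\<^sub>C 'b" and r :: real
  show "a * b * c = a * (b * c)" by (rule bcontfun_eqI) (simp add: mult.assoc)
  show "(a + b) * c = a * c + b * c" by (rule bcontfun_eqI) (simp add: distrib_right)
  show "a * (b + c) = a * b + a * c" by (rule bcontfun_eqI) (simp add: distrib_left)
  show "r *\<^sub>R a * b = r *\<^sub>R (a * b)" by (rule bcontfun_eqI) simp
  show "a * r *\<^sub>R b = r *\<^sub>R (a * b)" by (rule bcontfun_eqI) simp
  show "norm (a * b) \<le> norm a * norm b"
  proof (rule norm_bound)
    fix x
    have "norm (apply_bcontfun (a * b) x) \<le> norm (apply_bcontfun a x) * norm (apply_bcontfun b x)"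
      by (simp add: norm_mult_ineq)
    also have "\<dots> \<le> norm a * norm b"
      by (intro mult_mono norm_bounded) auto
    finally show "norm (apply_bcontfun (a * b) x) \<le> norm a * norm b" .
  qed
qed

end

definition scaleC :: "complex \<Rightarrow> ('a::topological_space \<Rightarrow>\<^sub>C complex) \<Rightarrow> 'a \<Rightarrow>\<^sub>C complex"
  where "scaleC c f = const_bcontfun c * f"

lemma apply_scaleC [simp]: "apply_bcontfun (scaleC c f) x = c * apply_bcontfun f x"
  by (simp add: scaleC_def const_bcontfun.rep_eq)

text \<open>This makes the complex linear span available as \<open>complex_vs.span\<close>.\<close>

global_interpretation complex_vs: vector_space "scaleC :: complex \<Rightarrow> ('a::topological_space \<Rightarrow>\<^sub>C complex) \<Rightarrow> _"
  by unfold_locales (auto intro!: bcontfun_eqI simp: algebra_simps)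

definition dual_space :: "(('a::topological_space \<Rightarrow>\<^sub>C complex) \<Rightarrow> complex) set"
  where "dual_space = {\<mu>. bounded_linear \<mu> \<and> (\<forall>c f. \<mu> (scaleC c f) = c * \<mu> f)}"

definition states :: "(('a::topological_space \<Rightarrow>\<^sub>C complex) \<Rightarrow> complex) set"
  where "states = {\<omega> \<in> dual_space.
    (\<forall>f. (\<forall>s. apply_bcontfun f s \<in> \<real>\<^sub>\<ge>\<^sub>0) \<longrightarrow> \<omega> f \<in> \<real>\<^sub>\<ge>\<^sub>0) \<and> onorm \<omega> = 1}"

definition functional_times ::
    "(('a::topological_space \<Rightarrow>\<^sub>C complex) \<Rightarrow> complex) \<Rightarrow> ('a \<Rightarrow>\<^sub>C complex) \<Rightarrow> ('a \<Rightarrow>\<^sub>C complex) \<Rightarrow> complex"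
  where "functional_times \<mu> g = (\<lambda>x. \<mu> (g * x))"

text \<open>
  \<open>\<Delta>(f)\<close> is kept as the bounded separately continuous function \<open>(s, t) \<mapsto> f(st)\<close>.  Slicing a
  bounded separately continuous function \<open>F\<close> by \<open>\<mu> \<in> C(S)\<^sup>*\<close> integrates out one variable; as
  the measure belonging to \<open>\<mu>\<close> represents the functional \<open>\<mu>\<close>, the integral of \<open>s \<mapsto> F(s, t)\<close>
  is the value of \<open>\<mu>\<close> at that element of \<open>C(S)\<close>.
\<close>

definition comult :: "('a::topological_space \<Rightarrow> 'a \<Rightarrow> 'a) \<Rightarrow> ('a \<Rightarrow>\<^sub>C complex) \<Rightarrow> 'a \<Rightarrow> 'a \<Rightarrow> complex"
  where "comult m f = (\<lambda>s t. apply_bcontfun f (m s t))"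

definition slice_fst ::
    "(('a::topological_space \<Rightarrow>\<^sub>C complex) \<Rightarrow> complex) \<Rightarrow> ('a \<Rightarrow> 'a \<Rightarrow> complex) \<Rightarrow> 'a \<Rightarrow> complex"
  where "slice_fst \<mu> F = (\<lambda>t. \<mu> (Bcontfun (\<lambda>s. F s t)))"

definition slice_snd ::
    "(('a::topological_space \<Rightarrow>\<^sub>C complex) \<Rightarrow> complex) \<Rightarrow> ('a \<Rightarrow> 'a \<Rightarrow> complex) \<Rightarrow> 'a \<Rightarrow> complex"
  where "slice_snd \<mu> F = (\<lambda>s. \<mu> (Bcontfun (\<lambda>t. F s t)))"

text \<open>The functions handed to \<open>Bcontfun\<close> when slicing \<open>\<Delta>(f)\<close> are indeed in \<open>C(S)\<close>.\<close>

lemma (in compact_semitopological_semigroup) comult_separately_continuous: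
  "(\<lambda>s. comult m f s t) \<in> bcontfun" "(\<lambda>t. comult m f s t) \<in> bcontfun"
proof -
  have *: "(\<lambda>x. apply_bcontfun f (h x)) \<in> bcontfun" if "continuous_on UNIV h" for h :: "'a \<Rightarrow> 'a"
    using that by (intro bcontfun_normI[where b = "norm f"] norm_bounded
        continuous_on_compose2[OF continuous_on_apply_bcontfun[of UNIV f]]) auto
  show "(\<lambda>s. comult m f s t) \<in> bcontfun" "(\<lambda>t. comult m f s t) \<in> bcontfun"
    unfolding comult_def by (intro * continuous_right_translation continuous_left_translation)+
qed

text \<open>The slices \<open>f \<star> \<mu>\<close> and \<open>\<mu> \<star> f\<close>.\<close>

definition star_right ::
    "('a::topological_space \<Rightarrow> 'a \<Rightarrow> 'a) \<Rightarrow> ('a \<Rightarrow>\<^sub>C complex) \<Rightarrow> (('a \<Rightarrow>\<^sub>C complex) \<Rightarrow> complex) \<Rightarrow> 'a \<Rightarrow> complex"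
  where "star_right m f \<mu> = slice_fst \<mu> (comult m f)"

definition star_left ::
    "('a::topological_space \<Rightarrow> 'a \<Rightarrow> 'a) \<Rightarrow> (('a \<Rightarrow>\<^sub>C complex) \<Rightarrow> complex) \<Rightarrow> ('a \<Rightarrow>\<^sub>C complex) \<Rightarrow> 'a \<Rightarrow> complex"
  where "star_left m \<mu> f = slice_snd \<mu> (comult m f)"

text \<open>
  For a compact semitopological semigroup every slice of \<open>\<Delta>(f)\<close> is continuous (by
  Grothendieck's theorem on pointwise compact sets in \<open>C(S)\<close>), so quantifying over the \<open>h\<close>
  whose underlying function is a slice ranges over all the slices, as elements of \<open>C(S)\<close>.
\<close>

definition weak_cancellation_laws :: "('a::topological_space \<Rightarrow> 'a \<Rightarrow> 'a) \<Rightarrow> bool"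
  where "weak_cancellation_laws m \<longleftrightarrow> (\<forall>\<omega>\<in>states.
    closure (complex_vs.span {h. \<exists>f g. apply_bcontfun h = star_right m f (functional_times \<omega> g)}) = UNIV \<and>
    closure (complex_vs.span {h. \<exists>f g. apply_bcontfun h = star_left m (functional_times \<omega> g) f}) = UNIV)"

end

theory Submission
  imports Defs
begin

text \<open>
  Suppose that the weak cancellation laws hold.  Evaluated at the point mass of \<open>s\<close>, they say that
  the functions \<open>t \<mapsto> f (s \<cdot> t)\<close> and \<open>t \<mapsto> f (t \<cdot> s)\<close>, \<open>f \<in> C(S)\<close>, span dense subspaces of
  \<open>C(S)\<close>.  As \<open>C(S)\<close> separates the points of \<open>S\<close>, both translations by \<open>s\<close> are injective
  (\<open>left_cancel_if_star_right_dense\<close>, applied to \<open>S\<close> and to the opposite semigroup).  A compact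
  semitopological semigroup contains an idempotent in every closed subsemigroup, and together
  with cancellation this makes it a group (\<open>group_if_cancellative\<close>).

  Conversely, let \<open>S\<close> be a group.  The analytic input is that the map taking \<open>t\<close> to the
  translate \<open>s \<mapsto> f (s \<cdot> t)\<close> is continuous from \<open>S\<close> into \<open>C(S)\<close> with its norm (\<open>continuous_on_right_translate\<close>), which is in
  essence Ellis's theorem that the product is jointly continuous.  It follows from a theorem of
  Namioka type: a separately continuous function on a product of compact spaces has arbitrarily
  small oscillation, uniformly in the second variable, on some nonempty open set of first
  variables (\<open>separately_continuous_small_oscillation\<close>); in a group such an open set can be
  translated to every point.

  Norm continuity of translation shows that for \<open>h \<in> C(S)\<close> the function \<open>(s, t) \<mapsto> h t\<close> is
  a uniform limit of finite sums of functions \<open>g s * f (s \<cdot> t)\<close>: cover \<open>S\<close> by finitely many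
  neighbourhoods of points \<open>a\<close> such that \<open>h t\<close> is close to \<open>h (a\<^sup>-\<^sup>1 \<cdot> s \<cdot> t)\<close> for \<open>s\<close> near
  \<open>a\<close>, and take for the functions \<open>g\<close> a subordinate partition of unity
  (\<open>approximation_by_products\<close>).  A state applied in the variable \<open>s\<close> turns such a sum into
  a linear combination of slices and fixes \<open>h t\<close>, so the slices span a dense subspace
  (\<open>star_right_dense\<close>).  The other density statement is this one for the opposite group.
\<close>

section \<open>Oscillation of separately continuous functions\<close>

text \<open>
  The cluster point is described by the closed conditions it inherits from the tails of the
  sequence; for a non-metrizable space there need be no convergent subsequence.
\<close>

lemma compact_sequence_cluster_point:
  fixes z :: "nat \<Rightarrow> 'x::topological_space"
  assumes "compact (UNIV :: 'x set)"
  obtains c where "\<And>C N. closed C \<Longrightarrow> (\<And>n. n \<ge> N \<Longrightarrow> z n \<in> C) \<Longrightarrow> c \<in> C"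
proof -
  have "UNIV \<inter> (\<Inter>n\<in>UNIV. closure (z ` {n..})) \<noteq> {}"
  proof (rule compact_imp_fip_image[OF assms])
    fix I :: "nat set"
    assume "finite I"
    then obtain N where "\<forall>n\<in>I. n \<le> N"
      using finite_nat_set_iff_bounded_le by blast
    then have "z N \<in> (\<Inter>n\<in>I. closure (z ` {n..}))"
      using closure_subset by fastforce
    then show "UNIV \<inter> (\<Inter>n\<in>I. closure (z ` {n..})) \<noteq> {}"
      by blast
  qed auto
  then obtain c where c: "\<And>n. c \<in> closure (z ` {n..})"
    by blast
  have "c \<in> C" if "closed C" "\<And>n. n \<ge> N \<Longrightarrow> z n \<in> C" for C N
    using c[of N] closure_minimal[of "z ` {N..}" C] that by auto
  then show thesis
    using that by blast
qed

text \<open>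
  Here \<open>F\<close> is a finite set of parameters already considered.  By compactness finitely many
  points \<open>r\<close> represent every \<open>y\<close> up to a \<open>\<delta>\<close>-error in all \<open>f a\<close> with \<open>a \<in> F\<close>.  If
  \<open>\<delta>\<close>-closeness for \<open>F\<close> always forced \<open>\<epsilon>\<close>-closeness for the parameters in \<open>U\<close>, then each
  function \<open>f x\<close> with \<open>x \<in> U\<close> would be known up to \<open>\<epsilon>\<close> from its values at the finitely many
  \<open>r\<close>, and controlling these values by pointwise continuity in \<open>x\<close> would give a nonempty open
  subset of \<open>U\<close> on which \<open>f\<close> oscillates by at most \<open>4 * \<epsilon>\<close>.
\<close>

lemma large_oscillation_witness:
  fixes f :: "'x::topological_space \<Rightarrow> 'y::topological_space \<Rightarrow> 'b::metric_space"
  assumes compact: "compact (UNIV :: 'y set)"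
    and continuous_fst: "\<And>y. continuous_on UNIV (\<lambda>x. f x y)"
    and continuous_snd: "\<And>x. continuous_on UNIV (f x)"
    and "0 < \<epsilon>" "0 < \<delta>"
    and large: "\<And>V. open V \<Longrightarrow> V \<noteq> {} \<Longrightarrow> \<exists>x\<in>V. \<exists>x'\<in>V. \<exists>y. 4 * \<epsilon> < dist (f x y) (f x' y)"
    and U: "open U" "U \<noteq> {}"
    and "finite F"
  shows "\<exists>x\<in>U. \<exists>y y'. (\<forall>a\<in>F. dist (f a y) (f a y') < \<delta>) \<and> \<epsilon> < dist (f x y) (f x y')"
proof (rule ccontr)
  assume contra: "\<not> ?thesis"
  define N where "N y = (\<Inter>a\<in>F. {y'. dist (f a y) (f a y') < \<delta>})" for y
  have "open (N y)" for y
    unfolding N_def using \<open>finite F\<close>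
    by (intro open_INT ballI open_Collect_less continuous_intros continuous_snd)
  moreover have "y \<in> N y" for y
    using \<open>0 < \<delta>\<close> by (simp add: N_def)
  then have "UNIV \<subseteq> (\<Union>y. N y)"
    by blast
  ultimately obtain R where "finite R" and R: "UNIV \<subseteq> (\<Union>r\<in>R. N r)"
    by (metis compactE_image[OF compact])
  obtain x0 where "x0 \<in> U"
    using U by blast
  define V where "V = U \<inter> (\<Inter>r\<in>R. {x. dist (f x r) (f x0 r) < \<epsilon>})"
  have "open V"
    unfolding V_def using \<open>finite R\<close> U
    by (intro open_Int open_INT ballI open_Collect_less continuous_intros continuous_fst)
  moreover have "x0 \<in> V"
    using \<open>x0 \<in> U\<close> \<open>0 < \<epsilon>\<close> by (simp add: V_def)
  ultimately obtain x x' y where "x \<in> V" "x' \<in> V" and far: "4 * \<epsilon> < dist (f x y) (f x' y)"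
    using large[of V] by blast
  obtain r where "r \<in> R" "y \<in> N r"
    using R by blast
  have near: "dist (f a r) (f a y) \<le> \<epsilon>" if "a \<in> V" for a
    using contra that \<open>y \<in> N r\<close> by (force simp: V_def N_def not_less)
  have "dist (f a r) (f x0 r) < \<epsilon>" if "a \<in> V" for a
    using that \<open>r \<in> R\<close> by (simp add: V_def)
  note this[OF \<open>x \<in> V\<close>] this[OF \<open>x' \<in> V\<close>] near[OF \<open>x \<in> V\<close>] near[OF \<open>x' \<in> V\<close>]
  moreover have "dist (f x y) (f x' y)
      \<le> dist (f x r) (f x y) + dist (f x r) (f x0 r) + dist (f x' r) (f x0 r) + dist (f x' r) (f x' y)"
    by (smt (verit) dist_triangle dist_commute)
  ultimately show False
    using far by linarith
qed

text \<open>
  This is the core of Namioka's theorem on joint continuity.  If oscillation is large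
  everywhere, iterating the previous lemma produces parameters \<open>x n\<close> and pairs
  \<open>p n = (y n, y' n)\<close> such that \<open>f (x k)\<close> hardly distinguishes the two points of any later pair,
  while it separates the points of all earlier pairs by more than \<open>\<eta>\<close>.  Let \<open>c\<close> and \<open>d\<close> be
  cluster points of the parameters and of the pairs.  Sending first the parameters and then the
  pairs to the limit, \<open>f c\<close> separates the pair \<open>d\<close>; in the other order it does not.
\<close>

lemma separately_continuous_small_oscillation:
  fixes f :: "'x::topological_space \<Rightarrow> 'y::topological_space \<Rightarrow> 'b::metric_space"
  assumes compact_fst: "compact (UNIV :: 'x set)"
    and compact_snd: "compact (UNIV :: 'y set)"
    and continuous_fst: "\<And>y. continuous_on UNIV (\<lambda>x. f x y)"
    and continuous_snd: "\<And>x. continuous_on UNIV (f x)"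
    and "0 < \<epsilon>"
  shows "\<exists>U. open U \<and> U \<noteq> {} \<and> (\<forall>x\<in>U. \<forall>x'\<in>U. \<forall>y. dist (f x y) (f x' y) \<le> \<epsilon>)"
proof (rule ccontr)
  assume contra: "\<not> ?thesis"
  define \<eta> where "\<eta> = \<epsilon> / 4"
  have "0 < \<eta>"
    using \<open>0 < \<epsilon>\<close> by (simp add: \<eta>_def)
  have large: "\<exists>x\<in>V. \<exists>x'\<in>V. \<exists>y. 4 * \<eta> < dist (f x y) (f x' y)" if "open V" "V \<noteq> {}" for V
    using contra that by (auto simp: \<eta>_def not_le)
  \<comment> \<open>A state consists of the open set containing the newest and all later parameters, the finite
    set of parameters chosen so far, the newest parameter, and the newest pair of points.\<close>
  define P :: "'x set \<times> 'x set \<times> 'x \<times> 'y \<times> 'y \<Rightarrow> bool"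
    where "P = (\<lambda>(U, F, x, _). open U \<and> finite F \<and> x \<in> U \<and> x \<in> F)"
  define Q :: "nat \<Rightarrow> 'x set \<times> 'x set \<times> 'x \<times> 'y \<times> 'y \<Rightarrow> 'x set \<times> 'x set \<times> 'x \<times> 'y \<times> 'y \<Rightarrow> bool"
    where "Q = (\<lambda>n (U, F, _) (U', F', x, y, y'). U' \<subseteq> U \<and> F \<subseteq> F' \<and>
      (\<forall>a\<in>F. dist (f a y) (f a y') < 1 / Suc n) \<and> (\<forall>a\<in>U'. \<eta> < dist (f a y) (f a y')))"
  have "\<exists>s. \<forall>n. P (s n) \<and> Q n (s n) (s (Suc n))"
  proof (rule dependent_nat_choice)
    show "\<exists>t. P t"
      by (intro exI[of _ "(UNIV, {undefined}, undefined, undefined)"]) (simp add: P_def)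
  next
    fix t n
    assume "P t"
    then obtain U F x p where t: "t = (U, F, x, p)" and "open U" "finite F" "x \<in> U"
      by (auto simp: P_def split: prod.splits)
    then obtain b y y' where b: "b \<in> U" "\<eta> < dist (f b y) (f b y')"
      and yy': "\<forall>a\<in>F. dist (f a y) (f a y') < 1 / Suc n"
      using large_oscillation_witness[OF compact_snd continuous_fst continuous_snd \<open>0 < \<eta>\<close> _ large,
          of "1 / Suc n" U F] by auto
    define U' where "U' = U \<inter> {a. \<eta> < dist (f a y) (f a y')}"
    have "open U'"
      unfolding U'_def using \<open>open U\<close>
      by (intro open_Int open_Collect_less continuous_intros continuous_fst)
    then have "P (U', insert b F, b, y, y') \<and> Q n t (U', insert b F, b, y, y')"
      using \<open>finite F\<close> b yy' by (auto simp: P_def Q_def t U'_def)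
    then show "\<exists>t'. P t' \<and> Q n t t'"
      by blast
  qed
  then obtain s where s: "\<And>n. P (s n)" "\<And>n. Q n (s n) (s (Suc n))"
    by blast
  define U F x p where defs: "U n = fst (s n)" "F n = fst (snd (s n))" "x n = fst (snd (snd (s n)))"
    "p n = snd (snd (snd (s n)))" for n
  have "U (Suc n) \<subseteq> U n" "F n \<subseteq> F (Suc n)" for n
    using s(2)[of n] by (auto simp: Q_def defs split: prod.splits)
  then have U_mono: "U n \<subseteq> U k" and F_mono: "F k \<subseteq> F n" if "k \<le> n" for k n
    using lift_Suc_antimono_le[of U k n] lift_Suc_mono_le[of F k n] that by auto
  have x: "x n \<in> U n" "x n \<in> F n" for n
    using s(1)[of n] by (auto simp: P_def defs split: prod.splits)
  have close: "dist (f (x k) (fst (p (Suc n)))) (f (x k) (snd (p (Suc n)))) < 1 / Suc n" if "k \<le> n" for k n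
    using s(2)[of n] x(2)[of k] F_mono[OF that] by (auto simp: Q_def defs split: prod.splits)
  have apart: "\<eta> < dist (f (x n) (fst (p (Suc k)))) (f (x n) (snd (p (Suc k))))" if "Suc k \<le> n" for k n
    using s(2)[of k] x(1)[of n] U_mono[OF that] by (auto simp: Q_def defs split: prod.splits)
  obtain c where c: "\<And>C N. closed C \<Longrightarrow> (\<And>n. n \<ge> N \<Longrightarrow> x n \<in> C) \<Longrightarrow> c \<in> C"
    using compact_sequence_cluster_point[OF compact_fst, of x] by metis
  have "compact (UNIV :: ('y \<times> 'y) set)"
    using compact_Times[OF compact_snd compact_snd] by simp
  then obtain d where d: "\<And>C N. closed C \<Longrightarrow> (\<And>n. n \<ge> N \<Longrightarrow> p (Suc n) \<in> C) \<Longrightarrow> d \<in> C"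
    using compact_sequence_cluster_point[of "\<lambda>n. p (Suc n)"] by metis
  have continuous_dist: "continuous_on UNIV (\<lambda>q. dist (f a (fst q)) (f a (snd q)))" for a
    by (intro continuous_intros continuous_on_compose2[OF continuous_snd]) auto
  \<comment> \<open>For a fixed pair let the parameter run to \<open>c\<close>, then let the pair run to \<open>d\<close>.\<close>
  have "c \<in> {a. \<eta> \<le> dist (f a (fst (p (Suc k)))) (f a (snd (p (Suc k))))}" for k
    by (rule c[of _ "Suc k"]) (use apart in \<open>auto intro!: closed_Collect_le continuous_intros continuous_fst less_imp_le\<close>)
  then have "d \<in> {q. \<eta> \<le> dist (f c (fst q)) (f c (snd q))}"
    by (intro d[of _ 0]) (auto intro!: closed_Collect_le continuous_intros continuous_dist)
  \<comment> \<open>Now the other order: for a fixed parameter let the pair run to \<open>d\<close> first.\<close>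
  moreover have "f (x k) (fst d) = f (x k) (snd d)" for k
  proof -
    have "dist (f (x k) (fst d)) (f (x k) (snd d)) \<le> 1 / Suc n" for n
    proof -
      have "d \<in> {q. dist (f (x k) (fst q)) (f (x k) (snd q)) \<le> 1 / Suc n}"
      proof (rule d[of _ "max k n"])
        fix j assume "max k n \<le> j"
        then have "dist (f (x k) (fst (p (Suc j)))) (f (x k) (snd (p (Suc j)))) < 1 / Suc j"
          by (intro close) auto
        also have "1 / Suc j \<le> 1 / Suc n"
          using \<open>max k n \<le> j\<close> by (simp add: field_simps)
        finally show "p (Suc j) \<in> {q. dist (f (x k) (fst q)) (f (x k) (snd q)) \<le> 1 / Suc n}"
          by simp
      qed (intro closed_Collect_le continuous_intros continuous_dist)
      then show ?thesis
        by simp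
    qed
    then have "dist (f (x k) (fst d)) (f (x k) (snd d)) \<le> 0"
      using LIMSEQ_le_const[OF lim_1_over_n[THEN LIMSEQ_Suc]] by blast
    then show ?thesis
      by simp
  qed
  then have "c \<in> {a. dist (f a (fst d)) (f a (snd d)) \<le> 0}"
    by (intro c[of _ 0] closed_Collect_le continuous_intros continuous_fst) simp
  ultimately show False
    using \<open>0 < \<eta>\<close> by simp
qed

lemma continuous_imp_bcontfun:
  fixes f :: "'a::topological_space \<Rightarrow> 'b::metric_space"
  assumes "compact (UNIV :: 'a set)" "continuous_on UNIV f"
  shows "f \<in> bcontfun"
  using assms by (auto simp: bcontfun_def intro: compact_imp_bounded compact_continuous_image)

section \<open>States\<close>

lemma states_D:
  assumes "\<omega> \<in> states"
  shows "bounded_linear \<omega>" "\<omega> (scaleC c f) = c * \<omega> f"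
    "(\<And>s. apply_bcontfun f s \<in> \<real>\<^sub>\<ge>\<^sub>0) \<Longrightarrow> \<omega> f \<in> \<real>\<^sub>\<ge>\<^sub>0" "onorm \<omega> = 1"
  using assms by (auto simp: states_def dual_space_def)

lemma state_norm_le:
  assumes "\<omega> \<in> states"
  shows "norm (\<omega> f) \<le> norm f"
  using onorm[OF states_D(1)[OF assms], of f] by (simp add: states_D(4)[OF assms])

text \<open>
  Adding the constant \<open>norm f\<close> makes a real-valued \<open>f\<close> nonnegative.
\<close>

lemma state_real:
  assumes "\<omega> \<in> states" and real: "\<And>s. apply_bcontfun f s \<in> \<real>"
  shows "\<omega> f \<in> \<real>"
proof -
  interpret bounded_linear \<omega>
    by (rule states_D(1)[OF assms(1)])
  let ?r = "const_bcontfun (complex_of_real (norm f))"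
  have "\<omega> (f + ?r) \<in> \<real>\<^sub>\<ge>\<^sub>0"
  proof (rule states_D(3)[OF assms(1)])
    fix s
    have "\<bar>Re (apply_bcontfun f s)\<bar> \<le> norm f"
      using abs_Re_le_cmod norm_bounded by (rule order_trans)
    then show "apply_bcontfun (f + ?r) s \<in> \<real>\<^sub>\<ge>\<^sub>0"
      using real[of s] by (auto simp: complex_nonneg_Reals_iff complex_is_Real_iff)
  qed
  moreover have "\<omega> ?r \<in> \<real>\<^sub>\<ge>\<^sub>0"
    by (rule states_D(3)[OF assms(1)]) simp
  ultimately show ?thesis
    by (auto simp: add complex_nonneg_Reals_iff complex_is_Real_iff)
qed

text \<open>
  States are normalized by their norm, whereas averaging requires them to preserve constants.
  The link is that a positive functional attains its norm at the constant \<open>1\<close>: after multiplying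
  \<open>f\<close> by a scalar of modulus \<open>1\<close> the value \<open>\<omega> f\<close> is nonnegative, hence equal to the value at
  the real part, which is dominated pointwise by the constant \<open>norm f\<close>.
\<close>

lemma state_one:
  fixes \<omega> :: "('a::topological_space \<Rightarrow>\<^sub>C complex) \<Rightarrow> complex"
  assumes "\<omega> \<in> states"
  shows "\<omega> (const_bcontfun 1) = 1"
proof -
  interpret bounded_linear \<omega>
    by (rule states_D(1)[OF assms])
  let ?one = "const_bcontfun 1 :: 'a \<Rightarrow>\<^sub>C complex"
  have one: "\<omega> ?one \<in> \<real>\<^sub>\<ge>\<^sub>0"
    by (rule states_D(3)[OF assms]) simp
  have "norm (\<omega> f) \<le> Re (\<omega> ?one) * norm f" for f
  proof -
    define z where "z = (if \<omega> f = 0 then 1 else cnj (\<omega> f) / norm (\<omega> f))"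
    have "norm z = 1"
      by (simp add: z_def norm_divide)
    have z: "z * \<omega> f = norm (\<omega> f)"
      by (simp add: z_def complex_norm_square[symmetric] power2_eq_square mult.commute[of "cnj _"])
    define k where "k = scaleC z f"
    define R where "R = Bcontfun (\<lambda>s. complex_of_real (Re (apply_bcontfun k s)))"
    define J where "J = Bcontfun (\<lambda>s. complex_of_real (Im (apply_bcontfun k s)))"
    have R: "apply_bcontfun R s = Re (apply_bcontfun k s)" for s
      unfolding R_def
      by (subst Bcontfun_inverse)
        (auto intro!: bcontfun_normI[where b = "norm k"] continuous_intros
          intro: order_trans[OF abs_Re_le_cmod norm_bounded])
    have J: "apply_bcontfun J s = Im (apply_bcontfun k s)" for s
      unfolding J_def
      by (subst Bcontfun_inverse)
        (auto intro!: bcontfun_normI[where b = "norm k"] continuous_intros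
          intro: order_trans[OF abs_Im_le_cmod norm_bounded])
    have "k = R + scaleC \<i> J"
      by (rule bcontfun_eqI) (simp add: R J complex_eq)
    then have "\<omega> R + \<i> * \<omega> J = z * \<omega> f"
      using states_D(2)[OF assms] by (metis add k_def)
    moreover have "\<omega> R \<in> \<real>" "\<omega> J \<in> \<real>"
      using state_real[OF assms] by (simp_all add: R J)
    ultimately have "Re (\<omega> R) = norm (\<omega> f)"
      unfolding z by (auto simp: complex_eq_iff complex_is_Real_iff)
    moreover have "\<omega> (scaleC (norm f) ?one - R) \<in> \<real>\<^sub>\<ge>\<^sub>0"
    proof (rule states_D(3)[OF assms])
      fix s
      have "Re (apply_bcontfun k s) \<le> norm (apply_bcontfun k s)"
        by (rule complex_Re_le_cmod)
      also have "\<dots> \<le> norm f"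
        by (simp add: k_def norm_mult \<open>norm z = 1\<close> norm_bounded)
      finally show "apply_bcontfun (scaleC (norm f) ?one - R) s \<in> \<real>\<^sub>\<ge>\<^sub>0"
        by (simp add: R complex_nonneg_Reals_iff)
    qed
    ultimately show ?thesis
      using states_D(2)[OF assms] by (simp add: diff complex_nonneg_Reals_iff mult.commute)
  qed
  then have "onorm \<omega> \<le> Re (\<omega> ?one)"
    using one by (intro onorm_bound) (auto simp: complex_nonneg_Reals_iff)
  moreover have "Re (\<omega> ?one) \<le> 1"
    using complex_Re_le_cmod[of "\<omega> ?one"] state_norm_le[OF assms, of ?one] norm_bound[of ?one 1] by simp
  ultimately show ?thesis
    using one states_D(4)[OF assms] by (simp add: complex_nonneg_Reals_iff complex_eq_iff)
qed

section \<open>Norm continuity of translation on a compact semitopological group\<close>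

definition right_translate :: "('a::topological_space \<Rightarrow> 'a \<Rightarrow> 'a) \<Rightarrow> ('a \<Rightarrow>\<^sub>C complex) \<Rightarrow> 'a \<Rightarrow> ('a \<Rightarrow>\<^sub>C complex)"
  where "right_translate m f t = Bcontfun (\<lambda>s. apply_bcontfun f (m s t))"

lemma star_right_eq: "star_right m f \<mu> t = \<mu> (right_translate m f t)"
  by (simp add: star_right_def slice_fst_def comult_def right_translate_def)

text \<open>
  Passing to the opposite semigroup exchanges the two slices, so all that follows is needed for
  \<open>star_right\<close> only.
\<close>

lemma star_left_eq_star_right_opposite: "star_left m \<mu> f = star_right (\<lambda>x y. m y x) f \<mu>"
  by (simp add: star_left_def star_right_def slice_fst_def slice_snd_def comult_def)

context compact_semitopological_semigroup
begin

lemma opposite: "compact_semitopological_semigroup (\<lambda>x y. y \<cdot> x)"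
  by unfold_locales
    (simp_all add: assoc compact_UNIV continuous_left_translation continuous_right_translation)

lemma apply_right_translate [simp]:
  "apply_bcontfun (right_translate m f t) s = apply_bcontfun f (s \<cdot> t)"
  using comult_separately_continuous(1)[of f t]
  by (simp add: right_translate_def comult_def Bcontfun_inverse)

end

locale compact_semitopological_group =
  compact_semitopological_semigroup m + Groups.group m e i
  for m :: "'a::t2_space \<Rightarrow> 'a \<Rightarrow> 'a" (infixl \<open>\<cdot>\<close> 70) and e i
begin

lemma opposite_group: "compact_semitopological_group (\<lambda>x y. y \<cdot> x) e i"
proof -
  interpret op: compact_semitopological_semigroup "\<lambda>x y. y \<cdot> x"
    by (rule opposite)
  show ?thesis
    by unfold_locales simp_all
qed

text \<open>
  The distance \<open>dist (right_translate m f t) (right_translate m f t')\<close> is a supremum over all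
  left factors \<open>s\<close>, so it does not change when \<open>t\<close> and \<open>t'\<close> are both multiplied from the left
  by the same element.  Hence a nonempty open set of small diameter, which exists by
  \<open>separately_continuous_small_oscillation\<close>, can be moved by the homeomorphism \<open>t \<mapsto> a \<cdot> t\<close> to a
  neighbourhood of any given point.
\<close>

lemma continuous_on_right_translate: "continuous_on UNIV (right_translate m f)"
  unfolding continuous_on_def
proof (intro ballI tendstoI)
  fix t0 :: 'a and \<epsilon> :: real
  assume "0 < \<epsilon>"
  have "\<exists>U. open U \<and> U \<noteq> {} \<and>
      (\<forall>x\<in>U. \<forall>x'\<in>U. \<forall>s. dist (apply_bcontfun f (s \<cdot> x)) (apply_bcontfun f (s \<cdot> x')) \<le> \<epsilon> / 2)"
  proof (rule separately_continuous_small_oscillation[OF compact_UNIV compact_UNIV])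
    show "continuous_on UNIV (\<lambda>x. apply_bcontfun f (s \<cdot> x))" for s
      by (rule continuous_on_compose2[OF continuous_on_apply_bcontfun[of UNIV] continuous_left_translation]) simp
    show "continuous_on UNIV (\<lambda>s. apply_bcontfun f (s \<cdot> x))" for x
      by (rule continuous_on_compose2[OF continuous_on_apply_bcontfun[of UNIV] continuous_right_translation]) simp
  qed (use \<open>0 < \<epsilon>\<close> in simp)
  then obtain U u where "open U" "u \<in> U" and
    U: "\<And>x x' s. x \<in> U \<Longrightarrow> x' \<in> U \<Longrightarrow> dist (apply_bcontfun f (s \<cdot> x)) (apply_bcontfun f (s \<cdot> x')) \<le> \<epsilon> / 2"
    by blast
  define a where "a = u \<cdot> i t0"
  define V where "V = (\<lambda>t. a \<cdot> t) -` U"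
  have "open V"
    unfolding V_def using \<open>open U\<close> continuous_left_translation by (rule open_vimage)
  moreover have "t0 \<in> V"
    using \<open>u \<in> U\<close> by (simp add: V_def a_def assoc)
  moreover have "dist (right_translate m f t) (right_translate m f t0) < \<epsilon>" if "t \<in> V" for t
  proof -
    have "dist (right_translate m f t) (right_translate m f t0) \<le> \<epsilon> / 2"
    proof (rule dist_bound)
      fix s
      have "s \<cdot> i a \<cdot> (a \<cdot> r) = s \<cdot> r" for r
        by (metis assoc left_inverse left_neutral)
      then show "dist (apply_bcontfun (right_translate m f t) s) (apply_bcontfun (right_translate m f t0) s) \<le> \<epsilon> / 2"
        using U[of "a \<cdot> t" "a \<cdot> t0" "s \<cdot> i a"] that \<open>t0 \<in> V\<close> by (simp add: V_def)
    qed
    then show ?thesis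
      using \<open>0 < \<epsilon>\<close> by simp
  qed
  ultimately show "\<forall>\<^sub>F t in at t0. dist (right_translate m f t) (right_translate m f t0) < \<epsilon>"
    unfolding eventually_at_topological by blast
qed

section \<open>Density of the slices\<close>

text \<open>
  Norm continuity of translation makes the distance from \<open>h\<close> to its translate by \<open>s\<close>
  a continuous function of \<open>s\<close>; truncating it yields the bump.
\<close>

lemma bump_at_neutral:
  fixes h :: "'a \<Rightarrow>\<^sub>C complex"
  assumes "0 < \<epsilon>"
  obtains p :: "'a \<Rightarrow> real" where "continuous_on UNIV p" "\<And>s. 0 \<le> p s" "0 < p e"
    "\<And>s t. p s \<noteq> 0 \<Longrightarrow> dist (apply_bcontfun h (s \<cdot> t)) (apply_bcontfun h t) \<le> \<epsilon>"
proof -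
  interpret op: compact_semitopological_group "\<lambda>x y. y \<cdot> x" e i
    by (rule opposite_group)
  let ?L = "right_translate (\<lambda>x y. y \<cdot> x) h"
  define p where "p s = max 0 (\<epsilon> - dist (?L s) h)" for s
  have "continuous_on UNIV p"
    unfolding p_def by (intro continuous_intros op.continuous_on_right_translate)
  moreover have "?L e = h"
    by (rule bcontfun_eqI) simp
  then have "0 < p e"
    using assms by (simp add: p_def)
  moreover have "dist (apply_bcontfun h (s \<cdot> t)) (apply_bcontfun h t) \<le> \<epsilon>" if "p s \<noteq> 0" for s t
    using that dist_bounded[of "?L s" t h] by (auto simp: p_def max_def split: if_splits)
  ultimately show thesis
    using that by (simp add: p_def)
qed

text \<open>
  By compactness finitely many left translates \<open>s \<mapsto> p (i a \<cdot> s)\<close> of a bump at the neutral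
  element have no common zero, so they can be divided by their sum.
\<close>

lemma translated_partition_of_unity:
  fixes p :: "'a \<Rightarrow> real"
  assumes p: "continuous_on UNIV p" "\<And>s. 0 \<le> p s" "0 < p e"
  obtains A :: "'a set" and g :: "'a \<Rightarrow> 'a \<Rightarrow> real" where "finite A"
    "\<And>a. continuous_on UNIV (g a)" "\<And>a s. 0 \<le> g a s" "\<And>s. (\<Sum>a\<in>A. g a s) = 1"
    "\<And>a s. g a s \<noteq> 0 \<Longrightarrow> p (i a \<cdot> s) \<noteq> 0"
proof -
  define q where "q a s = p (i a \<cdot> s)" for a s
  have q: "continuous_on UNIV (q a)" for a
    unfolding q_def by (rule continuous_on_compose2[OF p(1) continuous_left_translation]) simp
  have cover: "UNIV \<subseteq> (\<Union>a. {s. 0 < q a s})"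
  proof
    fix s
    have "0 < q s s"
      using p(3) by (simp add: q_def)
    then show "s \<in> (\<Union>a. {s. 0 < q a s})"
      by blast
  qed
  have "open {s. 0 < q a s}" for a
    by (intro open_Collect_less continuous_intros q)
  then obtain A where "finite A" and A: "UNIV \<subseteq> (\<Union>a\<in>A. {s. 0 < q a s})"
    by (metis compactE_image[OF compact_UNIV _ cover])
  define w where "w s = (\<Sum>a\<in>A. q a s)" for s
  have "0 < w s" for s
  proof -
    obtain a where "a \<in> A" "0 < q a s"
      using A by blast
    then show ?thesis
      unfolding w_def using \<open>finite A\<close> p(2) by (intro sum_pos2[of A a]) (auto simp: q_def)
  qed
  then have w: "0 < w s" "w s \<noteq> 0" for s
    by (auto simp: less_imp_neq[symmetric])
  define g where "g a s = q a s / w s" for a s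
  show thesis
  proof
    show "continuous_on UNIV (g a)" for a
      unfolding g_def using w by (intro continuous_intros q) (auto simp: w_def intro!: continuous_intros q)
    show "0 \<le> g a s" for a s
      using w(1)[of s] p(2) by (simp add: g_def q_def less_imp_le)
    show "(\<Sum>a\<in>A. g a s) = 1" for s
      using w(2)[of s] by (simp add: g_def w_def flip: sum_divide_distrib)
    show "p (i a \<cdot> s) \<noteq> 0" if "g a s \<noteq> 0" for a s
      using that by (auto simp: g_def q_def)
  qed fact
qed

text \<open>
  The function \<open>(s, t) \<mapsto> h t\<close>, which ignores \<open>s\<close>, is approximated by functions that
  depend on \<open>t\<close> only through \<open>s \<cdot> t\<close>.  If \<open>s\<close> is close to \<open>a\<close> then \<open>i a \<cdot> s\<close> is close to the
  neutral element and \<open>h t\<close> is close to \<open>h (i a \<cdot> (s \<cdot> t))\<close>, uniformly in \<open>t\<close>.  A partition of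
  unity in \<open>s\<close> glues these local approximations together, with \<open>F a\<close> the translate of \<open>h\<close> by
  \<open>i a\<close>.
\<close>

lemma approximation_by_products:
  assumes "0 < \<epsilon>"
  obtains A :: "'a set" and F G :: "'a \<Rightarrow> 'a \<Rightarrow>\<^sub>C complex" where "finite A"
    "\<And>s t. norm (apply_bcontfun h t - (\<Sum>a\<in>A. apply_bcontfun (G a) s * apply_bcontfun (F a) (s \<cdot> t))) \<le> \<epsilon>"
proof -
  interpret op: compact_semitopological_group "\<lambda>x y. y \<cdot> x" e i
    by (rule opposite_group)
  obtain p :: "'a \<Rightarrow> real" where p: "continuous_on UNIV p" "\<And>s. 0 \<le> p s" "0 < p e"
    and close: "\<And>s t. p s \<noteq> 0 \<Longrightarrow> dist (apply_bcontfun h (s \<cdot> t)) (apply_bcontfun h t) \<le> \<epsilon>"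
    using bump_at_neutral[OF assms] by metis
  obtain A :: "'a set" and g :: "'a \<Rightarrow> 'a \<Rightarrow> real" where "finite A"
    and g: "\<And>a. continuous_on UNIV (g a)" "\<And>a s. 0 \<le> g a s" "\<And>s. (\<Sum>a\<in>A. g a s) = 1"
      "\<And>a s. g a s \<noteq> 0 \<Longrightarrow> p (i a \<cdot> s) \<noteq> 0"
    using translated_partition_of_unity[OF p] by metis
  define G where "G a = Bcontfun (\<lambda>s. complex_of_real (g a s))" for a
  have G: "apply_bcontfun (G a) s = g a s" for a s
    unfolding G_def
    by (subst Bcontfun_inverse) (auto intro!: continuous_imp_bcontfun compact_UNIV continuous_intros g(1))
  define F where "F a = right_translate (\<lambda>x y. y \<cdot> x) h (i a)" for a
  have "norm (apply_bcontfun h t - (\<Sum>a\<in>A. apply_bcontfun (G a) s * apply_bcontfun (F a) (s \<cdot> t))) \<le> \<epsilon>" for s t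
  proof -
    have "apply_bcontfun h t = (\<Sum>a\<in>A. complex_of_real (g a s)) * apply_bcontfun h t"
      by (simp add: g(3) flip: of_real_sum)
    then have "apply_bcontfun h t - (\<Sum>a\<in>A. apply_bcontfun (G a) s * apply_bcontfun (F a) (s \<cdot> t))
        = (\<Sum>a\<in>A. g a s * (apply_bcontfun h t - apply_bcontfun h (i a \<cdot> s \<cdot> t)))"
      by (simp add: G F_def assoc algebra_simps sum_subtractf sum_distrib_left sum_distrib_right)
    also have "norm \<dots> \<le> (\<Sum>a\<in>A. g a s * \<epsilon>)"
    proof (rule sum_norm_le)
      fix a
      show "norm (g a s * (apply_bcontfun h t - apply_bcontfun h (i a \<cdot> s \<cdot> t))) \<le> g a s * \<epsilon>"
        using close[OF g(4)[of a s], of t] g(2)[of a s]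
        by (cases "g a s = 0") (auto simp: norm_mult dist_norm norm_minus_commute intro!: mult_left_mono)
    qed
    also have "\<dots> = \<epsilon>"
      by (simp add: g(3) flip: sum_distrib_right)
    finally show ?thesis .
  qed
  with \<open>finite A\<close> show thesis
    using that by blast
qed

text \<open>
  Applying \<open>\<omega>\<close> in the variable \<open>s\<close> to the approximation above leaves \<open>h t\<close> unchanged, because
  \<open>\<omega>\<close> preserves constants, and turns the sum of products into a sum of slices at \<open>t\<close>.  The error
  does not grow because \<open>\<omega>\<close> has norm \<open>1\<close>, and the slices are continuous because translation is
  norm continuous.
\<close>

theorem star_right_dense:
  assumes "\<omega> \<in> states"
  shows "closure (complex_vs.span {h. \<exists>f g. apply_bcontfun h = star_right m f (functional_times \<omega> g)}) = UNIV"
    (is "closure (complex_vs.span ?X) = UNIV")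
proof -
  interpret bounded_linear \<omega>
    by (rule states_D(1)[OF assms])
  have "h \<in> closure (complex_vs.span ?X)" for h
    unfolding closure_approachable
  proof (intro allI impI)
    fix \<epsilon> :: real
    assume "0 < \<epsilon>"
    then obtain A :: "'a set" and F G :: "'a \<Rightarrow> 'a \<Rightarrow>\<^sub>C complex" where "finite A" and
      approx: "\<And>s t. norm (apply_bcontfun h t - (\<Sum>a\<in>A. apply_bcontfun (G a) s * apply_bcontfun (F a) (s \<cdot> t))) \<le> \<epsilon> / 2"
      using approximation_by_products[of "\<epsilon> / 2" h] by (metis half_gt_zero)
    define q where "q a = Bcontfun (star_right m (F a) (functional_times \<omega> (G a)))" for a
    have "continuous_on UNIV (\<lambda>t. \<omega> (G a * right_translate m (F a) t))" for a
      by (intro continuous_intros continuous_on continuous_on_right_translate)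
    then have q: "apply_bcontfun (q a) = star_right m (F a) (functional_times \<omega> (G a))" for a
      unfolding q_def
      by (intro Bcontfun_inverse continuous_imp_bcontfun[OF compact_UNIV])
        (simp add: star_right_eq[abs_def] functional_times_def)
    then have "(\<Sum>a\<in>A. q a) \<in> complex_vs.span ?X"
      by (intro complex_vs.span_sum complex_vs.span_base) blast
    moreover have "dist (\<Sum>a\<in>A. q a) h \<le> \<epsilon> / 2"
    proof (rule dist_bound)
      fix t
      let ?D = "const_bcontfun (apply_bcontfun h t) - (\<Sum>a\<in>A. G a * right_translate m (F a) t)"
      have apply_sum: "apply_bcontfun (\<Sum>a\<in>A. k a) s = (\<Sum>a\<in>A. apply_bcontfun (k a) s)"
        for k :: "'a \<Rightarrow> 'a \<Rightarrow>\<^sub>C complex" and s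
        using \<open>finite A\<close> by induction simp_all
      have "const_bcontfun (apply_bcontfun h t) = scaleC (apply_bcontfun h t) (const_bcontfun 1 :: 'a \<Rightarrow>\<^sub>C complex)"
        by (rule bcontfun_eqI) simp
      then have "\<omega> (const_bcontfun (apply_bcontfun h t)) = apply_bcontfun h t"
        using states_D(2)[OF assms] state_one[OF assms] by simp
      then have "\<omega> ?D = apply_bcontfun h t - apply_bcontfun (\<Sum>a\<in>A. q a) t"
        by (simp add: diff sum apply_sum q star_right_eq functional_times_def)
      moreover have "norm ?D \<le> \<epsilon> / 2"
        using approx[where t = t] by (intro norm_bound) (simp add: apply_sum)
      ultimately show "dist (apply_bcontfun (\<Sum>a\<in>A. q a) t) (apply_bcontfun h t) \<le> \<epsilon> / 2"
        using state_norm_le[OF assms, of ?D] by (simp add: dist_norm norm_minus_commute)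
    qed
    ultimately show "\<exists>k\<in>complex_vs.span ?X. dist k h < \<epsilon>"
      using \<open>0 < \<epsilon>\<close> by (intro bexI[of _ "\<Sum>a\<in>A. q a"]) auto
  qed
  then show ?thesis
    by blast
qed

end

section \<open>Cancellative compact semitopological semigroups\<close>

text \<open>
  The Ellis--Numakura argument: in a minimal closed subsemigroup \<open>M\<close> with \<open>x \<in> M\<close>, minimality
  forces \<open>M \<cdot> x = M\<close>, so some element of \<open>M\<close> fixes \<open>x\<close> from the left; the elements doing so form
  a closed subsemigroup, which is again all of \<open>M\<close> and therefore contains \<open>x\<close> itself.
\<close>

lemma (in compact_semitopological_semigroup) exists_idempotent_in_subsemigroup:
  assumes T: "closed T" "T \<noteq> {}" "\<And>x y. x \<in> T \<Longrightarrow> y \<in> T \<Longrightarrow> x \<cdot> y \<in> T"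
  obtains x where "x \<in> T" "x \<cdot> x = x"
proof -
  define \<S> where "\<S> = {M. closed M \<and> M \<noteq> {} \<and> M \<subseteq> T \<and> (\<forall>x\<in>M. \<forall>y\<in>M. x \<cdot> y \<in> M)}"
  \<comment> \<open>Minimal members are maximal among the complements, for which Zorn's lemma is phrased.\<close>
  have "\<exists>M\<in>{A. - A \<in> \<S>}. \<forall>X\<in>{A. - A \<in> \<S>}. M \<subseteq> X \<longrightarrow> X = M"
  proof (rule subset_Zorn_nonempty)
    have "- T \<in> {A. - A \<in> \<S>}"
      using T by (simp add: \<S>_def)
    then show "{A. - A \<in> \<S>} \<noteq> {}"
      by blast
  next
    fix \<C> assume "\<C> \<noteq> {}" and chain: "subset.chain {A. - A \<in> \<S>} \<C>"
    then have \<C>: "- C \<in> \<S>" if "C \<in> \<C>" for C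
      using that by (auto simp: subset.chain_def)
    have "UNIV \<inter> \<Inter>(uminus ` \<C>) \<noteq> {}"
    proof (rule compact_imp_fip[OF compact_UNIV])
      fix \<F> assume "finite \<F>" "\<F> \<subseteq> uminus ` \<C>"
      then obtain \<D> where \<D>: "finite \<D>" "\<D> \<subseteq> \<C>" "\<F> = uminus ` \<D>"
        by (meson finite_subset_image)
      show "UNIV \<inter> \<Inter>\<F> \<noteq> {}"
      proof (cases "\<D> = {}")
        case False
        have "subset.chain {A. - A \<in> \<S>} \<D>"
          using chain \<D>(2) unfolding subset.chain_def by blast
        then have "\<Union>\<D> \<in> \<D>"
          using Union_in_chain[OF \<D>(1) False] by blast
        then have "- (\<Union>\<D>) \<in> \<S>"
          using \<C> \<D> by blast
        then show ?thesis
          using \<D> by (auto simp: \<S>_def)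
      qed (use \<D> in simp)
    qed (use \<C> in \<open>auto simp: \<S>_def\<close>)
    then have "- \<Union>\<C> \<noteq> {}"
      by blast
    moreover have "closed (- \<Union>\<C>)"
      using \<C> by (auto simp: \<S>_def closed_def)
    moreover have "- \<Union>\<C> \<subseteq> T"
      using \<C> \<open>\<C> \<noteq> {}\<close> by (auto simp: \<S>_def)
    moreover have "x \<cdot> y \<in> - \<Union>\<C>" if "x \<in> - \<Union>\<C>" "y \<in> - \<Union>\<C>" for x y
      using \<C> that by (force simp: \<S>_def)
    ultimately show "\<Union>\<C> \<in> {A. - A \<in> \<S>}"
      by (simp add: \<S>_def)
  qed
  then obtain A where "- A \<in> \<S>" and A: "\<And>B. - B \<in> \<S> \<Longrightarrow> A \<subseteq> B \<Longrightarrow> B = A"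
    by blast
  define M where "M = - A"
  have M: "closed M" "M \<noteq> {}" "M \<subseteq> T" "\<And>x y. x \<in> M \<Longrightarrow> y \<in> M \<Longrightarrow> x \<cdot> y \<in> M"
    using \<open>- A \<in> \<S>\<close> by (auto simp: M_def \<S>_def)
  have minimal: "N = M" if "closed N" "N \<noteq> {}" "N \<subseteq> M" "\<And>x y. x \<in> N \<Longrightarrow> y \<in> N \<Longrightarrow> x \<cdot> y \<in> N" for N
    using A[of "- N"] that M(3) by (auto simp: M_def \<S>_def)
  obtain x where "x \<in> M"
    using M by blast
  have "(\<lambda>s. s \<cdot> x) ` M = M"
  proof (rule minimal)
    have "compact M"
      using compact_Int_closed[OF compact_UNIV \<open>closed M\<close>] by simp
    then show "closed ((\<lambda>s. s \<cdot> x) ` M)"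
      by (intro compact_imp_closed compact_continuous_image
          continuous_on_subset[OF continuous_right_translation]) auto
    show "y \<cdot> z \<in> (\<lambda>s. s \<cdot> x) ` M" if "y \<in> (\<lambda>s. s \<cdot> x) ` M" "z \<in> (\<lambda>s. s \<cdot> x) ` M" for y z
    proof -
      obtain a b where "a \<in> M" "b \<in> M" "y = a \<cdot> x" "z = b \<cdot> x"
        using \<open>y \<in> _\<close> \<open>z \<in> _\<close> by blast
      then have "y \<cdot> z = (a \<cdot> x \<cdot> b) \<cdot> x" "a \<cdot> x \<cdot> b \<in> M"
        using M(4) \<open>x \<in> M\<close> by (simp_all add: assoc)
      then show ?thesis
        by blast
    qed
  qed (use M \<open>x \<in> M\<close> in auto)
  then obtain y where "y \<in> M" "y \<cdot> x = x"
    using \<open>x \<in> M\<close> by (metis imageE)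
  then have "M \<inter> {s. s \<cdot> x = x} \<noteq> {}"
    by auto
  then have "M \<inter> {s. s \<cdot> x = x} = M"
  proof (intro minimal)
    have "closed {s. s \<cdot> x = x}"
      using continuous_right_translation by (intro closed_Collect_eq continuous_intros)
    then show "closed (M \<inter> {s. s \<cdot> x = x})"
      using M(1) by (rule closed_Int[rotated])
  qed (use M in \<open>auto simp: assoc\<close>)
  then have "x \<cdot> x = x"
    using \<open>x \<in> M\<close> by blast
  then show thesis
    using that \<open>x \<in> M\<close> M(3) by blast
qed

text \<open>
  Cancellation makes any idempotent a two-sided neutral element, so there is only one.  Each left
  ideal \<open>S \<cdot> x\<close> is a closed subsemigroup, hence contains an idempotent, that is, the neutral
  element; this provides a left inverse of \<open>x\<close>.
\<close>

lemma (in compact_semitopological_semigroup) group_if_cancellative: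
  assumes left: "\<And>s t t'. s \<cdot> t = s \<cdot> t' \<Longrightarrow> t = t'"
    and right: "\<And>s t t'. t \<cdot> s = t' \<cdot> s \<Longrightarrow> t = t'"
  shows "\<exists>e i. Groups.group m e i"
proof -
  obtain e where e: "e \<cdot> e = e"
    using exists_idempotent_in_subsemigroup[of UNIV] by auto
  have neutral: "e \<cdot> x = x" "x \<cdot> e = x" for x
    using left[of e "e \<cdot> x" x] right[of "x \<cdot> e" e x] by (simp_all add: e assoc flip: assoc[of e e])
  have "\<exists>y. y \<cdot> x = e" for x
  proof -
    obtain f where "f \<in> range (\<lambda>y. y \<cdot> x)" "f \<cdot> f = f"
    proof (rule exists_idempotent_in_subsemigroup)
      show "closed (range (\<lambda>y. y \<cdot> x))"
        by (intro compact_imp_closed compact_continuous_image continuous_right_translation compact_UNIV)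
      show "a \<cdot> b \<in> range (\<lambda>y. y \<cdot> x)" if "a \<in> range (\<lambda>y. y \<cdot> x)" "b \<in> range (\<lambda>y. y \<cdot> x)" for a b
        using that by (auto simp flip: assoc)
    qed auto
    then show ?thesis
      using left[of f f e] neutral(2) by auto
  qed
  then obtain i where "\<And>x. i x \<cdot> x = e"
    by metis
  then have "Groups.group m e i"
    by unfold_locales (simp_all add: neutral)
  then show ?thesis
    by blast
qed

section \<open>Cancellation from the density of slices\<close>

lemma point_evaluation_in_states:
  "(\<lambda>f :: 'a::topological_space \<Rightarrow>\<^sub>C complex. apply_bcontfun f s) \<in> states"
proof -
  let ?\<delta> = "\<lambda>f :: 'a \<Rightarrow>\<^sub>C complex. apply_bcontfun f s"
  have linear: "bounded_linear ?\<delta>"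
    by (rule bounded_linear_intro[where K = 1]) (simp_all add: norm_bounded)
  have "norm (const_bcontfun 1 :: 'a \<Rightarrow>\<^sub>C complex) \<le> 1"
    by (rule norm_bound) simp
  then have "onorm ?\<delta> * norm (const_bcontfun 1 :: 'a \<Rightarrow>\<^sub>C complex) \<le> onorm ?\<delta> * 1"
    using onorm_pos_le[OF linear] by (rule mult_left_mono)
  then have "1 \<le> onorm ?\<delta>"
    using onorm[OF linear, of "const_bcontfun 1"] by simp
  moreover have "onorm ?\<delta> \<le> 1"
    by (rule onorm_bound) (simp_all add: norm_bounded)
  ultimately show ?thesis
    using linear by (simp add: states_def dual_space_def)
qed

lemma bcontfun_separates_points:
  fixes t t' :: "'a::t2_space"
  assumes "compact (UNIV :: 'a set)" "t \<noteq> t'"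
  obtains h :: "'a \<Rightarrow>\<^sub>C complex" where "apply_bcontfun h t \<noteq> apply_bcontfun h t'"
proof -
  have "Hausdorff_space (euclidean :: 'a topology)"
    unfolding Hausdorff_space_def disjnt_def by (metis hausdorff open_openin)
  then have "normal_space (euclidean :: 'a topology)"
    using assms(1) by (intro compact_Hausdorff_or_regular_imp_normal_space) (auto simp: compact_space_def)
  then obtain u :: "'a \<Rightarrow> real" where u: "continuous_on UNIV u" "u t = 0" "u t' = 1"
    using Urysohn_lemma_alt[of euclidean "{t}" "{t'}" 0 1] assms(2) by (auto simp: disjnt_def)
  have "(\<lambda>x. complex_of_real (u x)) \<in> bcontfun"
    by (intro continuous_imp_bcontfun assms(1) continuous_intros u(1))
  then show thesis
    using that[of "Bcontfun (\<lambda>x. complex_of_real (u x))"] u by (simp add: Bcontfun_inverse)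
qed

text \<open>
  For \<open>\<omega>\<close> the evaluation at \<open>s\<close>, the slices are the functions \<open>t \<mapsto> g s * f (s \<cdot> t)\<close>.
  If \<open>s \<cdot> t = s \<cdot> t'\<close>, all of them take the same value at \<open>t\<close> and \<open>t'\<close>, and so do the functions
  in their closed linear span.  That span is everything, and continuous functions separate points.
\<close>

lemma (in compact_semitopological_semigroup) left_cancel_if_star_right_dense:
  assumes dense: "\<forall>\<omega>\<in>states.
      closure (complex_vs.span {h. \<exists>f g. apply_bcontfun h = star_right m f (functional_times \<omega> g)}) = UNIV"
    and "s \<cdot> t = s \<cdot> t'"
  shows "t = t'"
proof (rule ccontr)
  assume "t \<noteq> t'"
  then obtain h :: "'a \<Rightarrow>\<^sub>C complex" where h: "apply_bcontfun h t \<noteq> apply_bcontfun h t'"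
    using bcontfun_separates_points[OF compact_UNIV] by metis
  let ?\<delta> = "\<lambda>f :: 'a \<Rightarrow>\<^sub>C complex. apply_bcontfun f s"
  let ?X = "{h. \<exists>f g. apply_bcontfun h = star_right m f (functional_times ?\<delta> g)}"
  let ?E = "{h :: 'a \<Rightarrow>\<^sub>C complex. apply_bcontfun h t = apply_bcontfun h t'}"
  have "?X \<subseteq> ?E"
    using \<open>s \<cdot> t = s \<cdot> t'\<close> by (auto simp: star_right_eq functional_times_def)
  moreover have "complex_vs.subspace ?E"
    by (simp add: complex_vs.subspace_def)
  ultimately have "complex_vs.span ?X \<subseteq> ?E"
    by (rule complex_vs.span_minimal)
  moreover have "closed ?E"
  proof -
    have "bounded_linear (\<lambda>h :: 'a \<Rightarrow>\<^sub>C complex. apply_bcontfun h r)" for r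
      using point_evaluation_in_states by (rule states_D(1))
    then show ?thesis
      by (intro closed_Collect_eq linear_continuous_on)
  qed
  ultimately have "closure (complex_vs.span ?X) \<subseteq> ?E"
    by (rule closure_minimal)
  then show False
    using h dense[rule_format, OF point_evaluation_in_states, of s] by auto
qed

section \<open>Groups and weak cancellation\<close>

theorem theorem4p3:
  fixes m :: "'a::t2_space \<Rightarrow> 'a \<Rightarrow> 'a"
  assumes "compact_semitopological_semigroup m"
  shows "(\<exists>e i. Groups.group m e i) \<longleftrightarrow> weak_cancellation_laws m"
proof
  assume "\<exists>e i. Groups.group m e i"
  then obtain e i where "Groups.group m e i"
    by blast
  with assms have group: "compact_semitopological_group m e i"
    by (rule compact_semitopological_group.intro)
  show "weak_cancellation_laws m"
    unfolding weak_cancellation_laws_def star_left_eq_star_right_opposite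
    using compact_semitopological_group.star_right_dense[OF group]
      compact_semitopological_group.star_right_dense[OF compact_semitopological_group.opposite_group[OF group]]
    by simp
next
  interpret compact_semitopological_semigroup m
    by fact
  interpret op: compact_semitopological_semigroup "\<lambda>x y. m y x"
    by (rule opposite)
  assume "weak_cancellation_laws m"
  then have dense: "\<forall>\<omega>\<in>states.
      closure (complex_vs.span {h. \<exists>f g. apply_bcontfun h = star_right m f (functional_times \<omega> g)}) = UNIV"
    "\<forall>\<omega>\<in>states.
      closure (complex_vs.span {h. \<exists>f g. apply_bcontfun h = star_right (\<lambda>x y. m y x) f (functional_times \<omega> g)}) = UNIV"
    by (simp_all add: weak_cancellation_laws_def star_left_eq_star_right_opposite)
  show "\<exists>e i. Groups.group m e i"
    by (rule group_if_cancellative)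
      (erule left_cancel_if_star_right_dense[OF dense(1)] op.left_cancel_if_star_right_dense[OF dense(2)])+
qed

end
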